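(* Let $f,g:\mathbb{R}^N\to\mathbb{R}\cup\{+\infty\}$, $F=f+g$ and $\mathcal{D}=\operatorname{int}(\operatorname{dom} f)$ satisfy assumptions (A1), (A2) of the context, let $x^0\in\operatorname{dom} g$, and let $(x^k)_{k\in\mathbb{N}}$ be the sequence generated by the variable Bregman MM algorithm of the context. Assume moreover: (A3)(a) there exists $\underline{\gamma}>0$ such that, for every $k\in\mathbb{N}$ and every $x\in\operatorname{dom} g$, $Q_f(x,x^k)-f(x)\ge \frac{\gamma_k}{2}\|x-x^k\|^2$ with $\gamma_k\in[\underline{\gamma},+\infty)$; (A3)(b) there exists $\overline{L}>0$ such that, for every $k\in\mathbb{N}$, $\nabla f-\nabla h_{x^k}$ is $L_k$-Lipschitz on every compact subset of $\operatorname{dom} g$, with $L_k\le\overline{L}$. Then: (i) the sequence $(F(x^k))_{k\in\mathbb{N}}$ is nonincreasing and, for every $k\in\mathbb{N}$, $F(x^k)-F(x^{k+1})\ge\frac{\underline{\gamma}}{2}\|x^{k+1}-x^k\|^2$; (ii) $\sum_{k=0}^{+\infty}\|x^{k+1}-x^k\|^2<+\infty$ and, in particular, $\|x^{k+1}-x^k\|\to0$ as $k\to\infty$.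
   Context: $\langle\cdot,\cdot\rangle$ and $\|\cdot\|$ are the Euclidean inner product and norm of $\mathbb{R}^N$; $\operatorname{dom} f=\{x: f(x)<+\infty\}$; $\Gamma_0(\mathbb{R}^N)$ is the set of proper lower semicontinuous convex functions $\mathbb{R}^N\to\mathbb{R}\cup\{+\infty\}$. Legendre functions. $h\in\Gamma_0(\mathbb{R}^N)$ is essentially smooth if it is differentiable on $\operatorname{int}(\operatorname{dom} h)$ and $\|\nabla h(y^k)\|\to+\infty$ for every sequence $(y^k)$ in $\operatorname{int}(\operatorname{dom} h)$ converging to a boundary point of $\operatorname{dom} h$. It is Legendre if it is essentially smooth and strictly convex on $\operatorname{int}(\operatorname{dom} h)$. $\mathcal{L}(\mathbb{R}^N)$ is the set of Legendre functions. For $h\in\mathcal{L}(\mathbb{R}^N)$ and $(x,y)\in\operatorname{dom} h\times\operatorname{int}(\operatorname{dom} h)$, the Bregman distance is $D_h(x,y)=h(x)-h(y)-\langle\nabla h(y),x-y\rangle$. (A1) (a) $f:\mathbb{R}^N\to\mathbb{R}\cup\{+\infty\}$ is proper, $\mathcal{D}:=\operatorname{int}(\operatorname{dom} f)$ is nonempty and $f$ is continuously differentiable on $\mathcal{D}$. (b) $g:\mathbb{R}^N\to\mathbb{R}\cup\{+\infty\}$ is proper, lower semicontinuous, convex, with $\operatorname{dom} g\subset\mathcal{D}$. (c) $F=f+g$ is coercive, continuous on its domain, and bounded below by some $\underline{F}>-\infty$. (A2) There is a family $(h_z)_{z\in\mathcal{D}}$ in $\mathcal{L}(\mathbb{R}^N)$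 with $\mathcal{D}\subset\operatorname{int}(\operatorname{dom} h_z)$ for every $z\in\mathcal{D}$ such that, with $Q_f(x,z)=f(z)+\langle\nabla f(z),x-z\rangle+D_{h_z}(x,z)$, one has $f(x)\le Q_f(x,z)$ for all $x,z\in\mathcal{D}$. Algorithm. Starting from $x^0\in\operatorname{dom} g$, for $k=0,1,\dots$: $x^{k+1}=\operatorname{argmin}_{x\in\mathbb{R}^N}\big(Q_f(x,x^k)+g(x)\big)$, where the objective is $+\infty$ outside $\operatorname{dom} g$. (Under (A1), (A2) this minimizer exists, is unique and lies in $\operatorname{dom} g$.) *)

theory Defs
  imports "HOL-Analysis.Analysis"
begin

text \<open>Functions with values in \<open>\<real> \<union> {+\<infinity>}\<close> are modelled as \<^typ>\<open>ereal\<close>-valued functions; the value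
  \<open>-\<infinity>\<close> is excluded by properness.\<close>

definition edom :: "('a \<Rightarrow> ereal) \<Rightarrow> 'a set" where
  "edom f = {x. f x < \<infinity>}"

definition proper :: "('a \<Rightarrow> ereal) \<Rightarrow> bool" where
  "proper f \<longleftrightarrow> edom f \<noteq> {} \<and> (\<forall>x. f x \<noteq> -\<infinity>)"

definition lsc :: "('a::topological_space \<Rightarrow> ereal) \<Rightarrow> bool" where
  "lsc f \<longleftrightarrow> (\<forall>x. f x \<le> Liminf (at x) f)"

definition econvex :: "('a::real_vector \<Rightarrow> ereal) \<Rightarrow> bool" where
  "econvex f \<longleftrightarrow> (\<forall>x y t. 0 < t \<longrightarrow> t < 1 \<longrightarrow>
     f ((1 - t) *\<^sub>R x + t *\<^sub>R y) \<le> ereal (1 - t) * f x + ereal t * f y)"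

definition strictly_econvex_on :: "'a::real_vector set \<Rightarrow> ('a \<Rightarrow> ereal) \<Rightarrow> bool" where
  "strictly_econvex_on S f \<longleftrightarrow> (\<forall>x\<in>S. \<forall>y\<in>S. \<forall>t. x \<noteq> y \<longrightarrow> 0 < t \<longrightarrow> t < 1 \<longrightarrow>
     f ((1 - t) *\<^sub>R x + t *\<^sub>R y) < ereal (1 - t) * f x + ereal t * f y)"

definition Gamma0 :: "('a::real_normed_vector \<Rightarrow> ereal) set" where
  "Gamma0 = {f. proper f \<and> lsc f \<and> econvex f}"

text \<open>Derivatives are only taken at interior points of the domain, in a neighbourhood of which
  \<^const>\<open>real_of_ereal\<close> does not change the (finite) values.\<close>

definition edifferentiable_on :: "'a::real_inner set \<Rightarrow> ('a \<Rightarrow> ereal) \<Rightarrow> bool" where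
  "edifferentiable_on S f \<longleftrightarrow> (\<forall>x\<in>S. (\<lambda>u. real_of_ereal (f u)) differentiable (at x))"

definition grad :: "('a::real_inner \<Rightarrow> ereal) \<Rightarrow> 'a \<Rightarrow> 'a" where
  "grad f x = (THE D. GDERIV (\<lambda>u. real_of_ereal (f u)) x :> D)"

definition essentially_smooth :: "('a::real_inner \<Rightarrow> ereal) \<Rightarrow> bool" where
  "essentially_smooth h \<longleftrightarrow>
     edifferentiable_on (interior (edom h)) h \<and>
     (\<forall>y l. (\<forall>k. y k \<in> interior (edom h)) \<longrightarrow> y \<longlonglongrightarrow> l \<longrightarrow> l \<in> frontier (edom h) \<longrightarrow>
        filterlim (\<lambda>k. norm (grad h (y k))) at_top sequentially)"

definition Legendre_functions :: "('a::real_inner \<Rightarrow> ereal) set" where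
  "Legendre_functions =
     {h. h \<in> Gamma0 \<and> essentially_smooth h \<and> strictly_econvex_on (interior (edom h)) h}"

text \<open>For \<open>h\<close> Legendre and \<open>y\<close> in the interior of its domain, \<open>h y\<close> is finite, so that the Bregman
  distance is a finite number for \<open>x\<close> in the domain of \<open>h\<close> and \<open>\<infinity>\<close> for all other \<open>x\<close>.\<close>

definition bregman :: "('a::real_inner \<Rightarrow> ereal) \<Rightarrow> 'a \<Rightarrow> 'a \<Rightarrow> ereal" where
  "bregman h x y = h x - h y - ereal (inner (grad h y) (x - y))"

definition majorant ::
    "('a::real_inner \<Rightarrow> ereal) \<Rightarrow> ('a \<Rightarrow> 'a \<Rightarrow> ereal) \<Rightarrow> 'a \<Rightarrow> 'a \<Rightarrow> ereal" where
  "majorant f h x z = f z + ereal (inner (grad f z) (x - z)) + bregman (h z) x z"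

definition assumption_A1 :: "('a::real_inner \<Rightarrow> ereal) \<Rightarrow> ('a \<Rightarrow> ereal) \<Rightarrow> bool" where
  "assumption_A1 f g \<longleftrightarrow>
     (proper f \<and> interior (edom f) \<noteq> {} \<and> edifferentiable_on (interior (edom f)) f \<and>
        continuous_on (interior (edom f)) (grad f)) \<and>
     (proper g \<and> lsc g \<and> econvex g \<and> edom g \<subseteq> interior (edom f)) \<and>
     (let F = (\<lambda>x. f x + g x) in
        (F \<longlongrightarrow> \<infinity>) at_infinity \<and> continuous_on (edom F) F \<and> (\<exists>m::real. \<forall>x. ereal m \<le> F x))"

definition assumption_A2 :: "('a::real_inner \<Rightarrow> ereal) \<Rightarrow> ('a \<Rightarrow> 'a \<Rightarrow> ereal) \<Rightarrow> bool" where
  "assumption_A2 f h \<longleftrightarrow>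
     (\<forall>z\<in>interior (edom f). h z \<in> Legendre_functions \<and> interior (edom f) \<subseteq> interior (edom (h z))) \<and>
     (\<forall>x\<in>interior (edom f). \<forall>z\<in>interior (edom f). f x \<le> majorant f h x z)"

text \<open>Outside the domain of \<open>g\<close> the objective is \<open>\<infinity>\<close>, since addition of \<open>\<infinity>\<close> is absorbing on
  \<^typ>\<open>ereal\<close>.\<close>

definition bregman_MM_sequence ::
    "('a::real_inner \<Rightarrow> ereal) \<Rightarrow> ('a \<Rightarrow> ereal) \<Rightarrow> ('a \<Rightarrow> 'a \<Rightarrow> ereal) \<Rightarrow> (nat \<Rightarrow> 'a) \<Rightarrow> bool" where
  "bregman_MM_sequence f g h x \<longleftrightarrow>
     x 0 \<in> edom g \<and>
     (\<forall>k. is_arg_min (\<lambda>u. majorant f h u (x k) + g u) (\<lambda>_. True) (x (Suc k)))"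

end

theory Submission
  imports Defs
begin

text \<open>Comparing \<open>x\<^sup>k\<^sup>+\<^sup>1\<close> with \<open>x\<^sup>k\<close> in the minimisation gives
  \<open>Q\<^sub>f(x\<^sup>k\<^sup>+\<^sup>1, x\<^sup>k) + g(x\<^sup>k\<^sup>+\<^sup>1) \<le> Q\<^sub>f(x\<^sup>k, x\<^sup>k) + g(x\<^sup>k) = F(x\<^sup>k)\<close>, and the quadratic lower bound on \<open>Q\<^sub>f - f\<close>
  turns this into the sufficient decrease; the sum of squares then telescopes against the lower bound
  of \<open>F\<close>.\<close>

lemma proper_finite:
  assumes "proper f" "x \<in> edom f"
  shows "\<bar>f x\<bar> \<noteq> \<infinity>"
  using assms by (auto simp: proper_def edom_def)

text \<open>Finiteness makes \<open>h z z - h z z\<close> vanish; in \<open>ereal\<close>,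
  \<infinity> - \<infinity> is not 0.\<close>

lemma majorant_self:
  assumes "\<bar>h z z\<bar> \<noteq> \<infinity>"
  shows "majorant f h z z = f z"
  using assms by (simp add: majorant_def bregman_def zero_ereal_def[symmetric])

text \<open>One iteration from \<open>z\<close> to \<open>u\<close>. Membership of \<open>u\<close>
  in \<open>edom g\<close> comes first because \<open>quad\<close> is available only there; it also
  carries the induction over the iterates.\<close>

lemma MM_step_sufficient_decrease:
  fixes f g :: "'a::real_inner \<Rightarrow> ereal"
  assumes f: "proper f" and g: "proper g" and sub: "edom g \<subseteq> edom f"
    and hz: "\<bar>h z z\<bar> \<noteq> \<infinity>" and z: "z \<in> edom g"
    and min: "is_arg_min (\<lambda>u. majorant f h u z + g u) (\<lambda>_. True) u"
    and quad: "\<And>v. v \<in> edom g \<Longrightarrow> ereal (c * (norm (v - z))\<^sup>2) \<le> majorant f h v z - f v"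
  shows "u \<in> edom g" and "ereal (c * (norm (u - z))\<^sup>2) \<le> (f z + g z) - (f u + g u)"
proof -
  have fz: "\<bar>f z\<bar> \<noteq> \<infinity>" and gz: "\<bar>g z\<bar> \<noteq> \<infinity>"
    using proper_finite[OF f, of z] proper_finite[OF g z] z sub by auto
  \<comment> \<open>\<open>is_arg_min\<close> only excludes strictly smaller values; it is used at
    the competitor \<open>z\<close>.\<close>
  have le: "majorant f h u z + g u \<le> f z + g z"
    using min majorant_self[of h z f, OF hz] unfolding is_arg_min_def
    by (metis linorder_not_less)
  have "f z + g z < \<infinity>"
    using fz gz by auto
  then show u: "u \<in> edom g"
    using le by (auto simp: edom_def)
  have fu: "\<bar>f u\<bar> \<noteq> \<infinity>" and gu: "\<bar>g u\<bar> \<noteq> \<infinity>"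
    using proper_finite[OF f, of u] proper_finite[OF g u] u sub by auto
  show "ereal (c * (norm (u - z))\<^sup>2) \<le> (f z + g z) - (f u + g u)"
    \<comment> \<open>The majorant at \<open>u\<close> is finite too: \<open>le\<close> excludes
      \<infinity> and \<open>quad\<close> excludes -\<infinity>, so only real arithmetic
      remains.\<close>
    using le quad[OF u] fz gz fu gu
    by (cases "f z"; cases "g z"; cases "f u"; cases "g u"; cases "majorant f h u z") auto
qed

text \<open>Telescoping bounds all partial sums by \<open>(r 0 - m) / c\<close>, which suffices for
  nonnegative terms.\<close>

lemma summable_of_sufficient_decrease:
  fixes r a :: "nat \<Rightarrow> real"
  assumes c: "c > 0" and a: "\<And>k. 0 \<le> a k" and lower: "\<And>k. m \<le> r k"
    and dec: "\<And>k. c * a k \<le> r k - r (Suc k)"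
  shows "summable a"
proof (rule summableI_nonneg_bounded)
  show "(\<Sum>k<n. a k) \<le> (r 0 - m) / c" for n
  proof -
    have "c * (\<Sum>k<n. a k) \<le> (\<Sum>k<n. r k - r (Suc k))"
      unfolding sum_distrib_left by (rule sum_mono) (rule dec)
    also have "\<dots> = r 0 - r n"
      by (rule sum_lessThan_telescope')
    also have "\<dots> \<le> r 0 - m"
      using lower[of n] by simp
    finally show ?thesis
      using c by (simp add: field_simps)
  qed
qed (rule a)

theorem proposition4p2:
  fixes f g F :: "real ^ 'n \<Rightarrow> ereal"
    and h :: "real ^ 'n \<Rightarrow> real ^ 'n \<Rightarrow> ereal"
    and x :: "nat \<Rightarrow> real ^ 'n"
    and \<gamma> L :: "nat \<Rightarrow> real"
    and \<gamma>_low L_up :: real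
  defines "F \<equiv> (\<lambda>u. f u + g u)"
  assumes A1: "assumption_A1 f g"
    and A2: "assumption_A2 f h"
    and MM: "bregman_MM_sequence f g h x"
    and A3a: "\<gamma>_low > 0" "\<And>k. \<gamma> k \<ge> \<gamma>_low"
      "\<And>k u. u \<in> edom g \<Longrightarrow>
         majorant f h u (x k) - f u \<ge> ereal (\<gamma> k / 2 * (norm (u - x k))\<^sup>2)"
    and A3b: "L_up > 0" "\<And>k. L k \<le> L_up"
      "\<And>k K. compact K \<Longrightarrow> K \<subseteq> edom g \<Longrightarrow>
         (L k)-lipschitz_on K (\<lambda>u. grad f u - grad (h (x k)) u)"
  shows "(decseq (\<lambda>k. F (x k)) \<and>
          (\<forall>k. F (x k) - F (x (Suc k)) \<ge> ereal (\<gamma>_low / 2 * (norm (x (Suc k) - x k))\<^sup>2))) \<and>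
         (summable (\<lambda>k. (norm (x (Suc k) - x k))\<^sup>2) \<and>
          (\<lambda>k. norm (x (Suc k) - x k)) \<longlonglongrightarrow> 0)"
proof -
  have f: "proper f" and g: "proper g" and sub: "edom g \<subseteq> interior (edom f)"
    and bdd: "\<exists>m::real. \<forall>u. ereal m \<le> F u"
    using A1 by (auto simp: assumption_A1_def Let_def F_def)
  have sub': "edom g \<subseteq> edom f"
    using sub interior_subset by blast
  have h_finite: "\<bar>h z z\<bar> \<noteq> \<infinity>" if "z \<in> edom g" for z
  proof (rule proper_finite[of "h z" z])
    have "h z \<in> Legendre_functions" "interior (edom f) \<subseteq> interior (edom (h z))"
      using A2 sub that by (auto simp: assumption_A2_def)
    then show "proper (h z)" "z \<in> edom (h z)"
      using sub that interior_subset by (auto simp: Legendre_functions_def Gamma0_def)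
  qed
  \<comment> \<open>The uniform constant \<open>\<gamma>_low\<close> replaces
    \<open>\<gamma> k\<close>, so one \<open>c\<close> serves all iterations.\<close>
  have quad: "ereal (\<gamma>_low / 2 * (norm (u - x k))\<^sup>2) \<le> majorant f h u (x k) - f u"
    if "u \<in> edom g" for k u
  proof (rule order_trans[OF _ A3a(3)[OF that]])
    show "ereal (\<gamma>_low / 2 * (norm (u - x k))\<^sup>2) \<le> ereal (\<gamma> k / 2 * (norm (u - x k))\<^sup>2)"
      using A3a(2)[of k] by (simp add: mult_right_mono)
  qed
  have min: "is_arg_min (\<lambda>u. majorant f h u (x k) + g u) (\<lambda>_. True) (x (Suc k))" for k
    using MM by (simp add: bregman_MM_sequence_def)
  have x_dom: "x k \<in> edom g" for k
  proof (induction k)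
    case 0
    show ?case using MM by (simp add: bregman_MM_sequence_def)
  next
    case (Suc k)
    show ?case
      by (rule MM_step_sufficient_decrease(1)[OF f g sub' h_finite[OF Suc] Suc min quad])
  qed
  have decrease: "ereal (\<gamma>_low / 2 * (norm (x (Suc k) - x k))\<^sup>2) \<le> F (x k) - F (x (Suc k))" for k
    unfolding F_def
    by (rule MM_step_sufficient_decrease(2)[OF f g sub' h_finite[OF x_dom] x_dom min quad])
  \<comment> \<open>\<open>F\<close> is finite along the iterates, so the summation can be done over
    the reals.\<close>
  define r where "r k = real_of_ereal (F (x k))" for k
  have F_r: "F (x k) = ereal (r k)" for k
  proof -
    have "\<bar>f (x k)\<bar> \<noteq> \<infinity>" "\<bar>g (x k)\<bar> \<noteq> \<infinity>"
      using proper_finite[OF f, of "x k"] proper_finite[OF g, of "x k"] x_dom[of k] sub' by auto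
    then show ?thesis
      by (auto simp: F_def r_def)
  qed
  have r_decrease: "\<gamma>_low / 2 * (norm (x (Suc k) - x k))\<^sup>2 \<le> r k - r (Suc k)" for k
    using decrease[of k] by (simp add: F_r)
  obtain m where m: "m \<le> r k" for k
    using bdd F_r by (metis ereal_less_eq(3))
  have "r (Suc k) \<le> r k" for k
  proof -
    have "0 \<le> \<gamma>_low / 2 * (norm (x (Suc k) - x k))\<^sup>2"
      using A3a(1) by simp
    then show ?thesis using r_decrease[of k] by linarith
  qed
  then have "decseq (\<lambda>k. F (x k))"
    by (simp add: decseq_Suc_iff F_r)
  moreover have summ: "summable (\<lambda>k. (norm (x (Suc k) - x k))\<^sup>2)"
    using A3a(1) m r_decrease
    by (intro summable_of_sufficient_decrease[where c = "\<gamma>_low / 2" and m = m and r = r]) auto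
  \<comment> \<open>Terms of a convergent series tend to 0; continuity of the square root removes
    the squares.\<close>
  moreover have "(\<lambda>k. norm (x (Suc k) - x k)) \<longlonglongrightarrow> 0"
    using tendsto_real_sqrt[OF summable_LIMSEQ_zero[OF summ]] by simp
  ultimately show ?thesis
    using decrease by blast
qed

end
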